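(* Let $D_{i,K}$ be the number of pairs of consecutive roots at distance $i$ in the ballistic deposition process on the cyclic strip $[K]$. For every integer $i$ with $2\le i\le 7$, $\frac{D_{i,K}}{E(D_{i,K})}$ converges to $1$ in probability as $K\to\infty$.
   Context: Ballistic deposition on a strip: for an integer $K\ge 3$ let $[K]=\{1,\dots,K\}$, and define the (cyclic) neighbour sets $I(1)=\{K,1,2\}$, $I(k)=\{k-1,k,k+1\}$ for $2\le k\le K-1$, and $I(K)=\{K-1,K,1\}$. Let $(X_n)_{n\ge 0}$ be i.i.d. random variables uniformly distributed on $[K]$. Define random height functions $H_n:[K]\to\{0,1,2,\dots\}$ by $H_0(k)=0$ for all $k\in[K]$ and, for $n\ge 1$, $H_n(k)=H_{n-1}(k)$ if $X_n\ne k$, and $H_n(k)=\max_{j\in I(k)}H_{n-1}(j)+1$ if $X_n=k$. The set of roots eventually formed is $\mathcal R^{[K]}=\{k\in[K]: H_i(k)=1 \text{ for some } i\ge 1\}$, and $R^{[K]}=\mathrm{Card}(\mathcal R^{[K]})$. Let $r_1<\cdots<r_{R^{[K]}}$ be the ordered locations of the roots. For $1\le i\le K-1$ let $D_{i,K}=\sum_{j=1}^{R^{[K]}-1}\mathbf 1_{\{r_{j+1}-r_j=i+1\}}+\mathbf 1_{\{r_{R^{[K]}}-r_1=K-i-1\}}$ be the number of pairs of (cyclically) consecutive roots with distance $i$ (that is, $i$ non-root sites) between them. $E(X)$ denotes the mean of a random variable $X$. *)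

theory Defs
  imports "HOL-Probability.Probability"
begin

definition nbrs :: "nat \<Rightarrow> nat \<Rightarrow> nat set" where
  "nbrs K k =
     (if k = 1 then {K, 1, 2} else if k = K then {K - 1, K, 1} else {k - 1, k, k + 1})"

text \<open>
  The height function \<open>H\<^sub>n(k)\<close> driven by the site sequence \<open>x\<close>; the particle arriving at
  time \<open>n \<ge> 1\<close> falls on site \<open>x n\<close>, and \<open>x 0\<close> is never used.
\<close>

primrec height :: "nat \<Rightarrow> (nat \<Rightarrow> nat) \<Rightarrow> nat \<Rightarrow> nat \<Rightarrow> nat" where
  "height K x 0 k = 0"
| "height K x (Suc n) k =
     (if x (Suc n) = k then Max (height K x n ` nbrs K k) + 1 else height K x n k)"

definition roots :: "nat \<Rightarrow> (nat \<Rightarrow> nat) \<Rightarrow> nat set" where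
  "roots K x = {k \<in> {1..K}. \<exists>i\<ge>1. height K x i k = 1}"

definition num_roots :: "nat \<Rightarrow> (nat \<Rightarrow> nat) \<Rightarrow> nat" where
  "num_roots K x = card (roots K x)"

text \<open>
  The \<open>j\<close>-th smallest root, for \<open>1 \<le> j \<le> num_roots K x\<close>.
  Integer-valued, so that the differences below are not truncated.
\<close>

definition root_at :: "nat \<Rightarrow> (nat \<Rightarrow> nat) \<Rightarrow> nat \<Rightarrow> int" where
  "root_at K x j = int (sorted_list_of_set (roots K x) ! (j - 1))"

definition root_gaps :: "nat \<Rightarrow> nat \<Rightarrow> (nat \<Rightarrow> nat) \<Rightarrow> real" where
  "root_gaps i K x =
     (\<Sum>j = 1..num_roots K x - 1. of_bool (root_at K x (j + 1) - root_at K x j = int i + 1))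
     + of_bool (root_at K x (num_roots K x) - root_at K x 1 = int K - int i - 1)"

text \<open>
  Convergence in probability to a constant. Each variable may live on its own probability
  space; finitely many of them may be junk, as the model below exists only for \<open>K \<ge> 3\<close>.
  Measurability is part of the notion, because \<^const>\<open>measure\<close> is \<open>0\<close> on non-measurable sets.
\<close>

definition converges_in_probability ::
  "(nat \<Rightarrow> 'a measure) \<Rightarrow> (nat \<Rightarrow> 'a \<Rightarrow> real) \<Rightarrow> real \<Rightarrow> bool" where
  "converges_in_probability M Y c \<longleftrightarrow>
     (\<forall>\<^sub>F K in sequentially. prob_space (M K) \<and> Y K \<in> borel_measurable (M K)) \<and>
     (\<forall>\<epsilon>>0. (\<lambda>K. measure (M K) {\<omega> \<in> space (M K). \<bar>Y K \<omega> - c\<bar> > \<epsilon>}) \<longlonglongrightarrow> 0)"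

end

theory Submission
  imports Defs
begin

text \<open>
  Heights only grow, so a site becomes a root exactly when its first particle arrives before any
  particle has fallen on its neighbours. Writing \<open>T\<^sub>k\<close> for the time of the first arrival at \<open>k\<close>, the
  roots are the local minima of \<open>T\<close> on the cycle (\<open>mem_roots_iff_first_arrival\<close>), and a gap of length
  \<open>i\<close> is a block of \<open>i + 4\<close> consecutive sites on which the relative order of the \<open>T\<^sub>k\<close> shows a local
  minimum, then \<open>i\<close> sites that are not local minima, then a local minimum. The outer two sites of
  the block are only there to decide whether the extreme minima are local minima. Hence \<open>D\<^sub>i\<^sub>,\<^sub>K\<close> is a
  sum of \<open>K\<close> indicators, one for each position of the block (\<open>root_gaps_eq_count\<close>).

  The law of the arrival sequence is invariant under permutations of the sites, and almost surely
  the \<open>T\<^sub>k\<close> are finite and distinct. Averaging an order event on one block over all permutations of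
  that block replaces it by the constant fraction of orders which satisfy it, whatever happens
  outside the block (\<open>prob_pattern_and_invariant\<close>). So every indicator has the same mean \<open>p\<close>, which
  depends on \<open>i\<close> only, and indicators of disjoint blocks are uncorrelated, although the \<open>T\<^sub>k\<close>
  themselves are not independent. A block meets at most \<open>(i + 4)\<^sup>2\<close> others, so the variance of the
  sum is at most \<open>(i + 4)\<^sup>2 K\<close>, while its mean is \<open>K p\<close>. As \<open>p > 0\<close>, the inequality of Chebyshev
  bounds the probability of a relative deviation \<open>\<epsilon>\<close> by \<open>(i + 4)\<^sup>2 / (p \<epsilon>)\<^sup>2 / K\<close>
  (\<open>root_gaps_concentration\<close>), which tends to \<open>0\<close>.
\<close>

section \<open>Roots as local minima of the first arrival times\<close>

definition first_arrival :: "(nat \<Rightarrow> nat) \<Rightarrow> nat \<Rightarrow> nat" where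
  "first_arrival x k = (LEAST n. 1 \<le> n \<and> x n = k)"

definition all_sites_hit :: "nat \<Rightarrow> (nat \<Rightarrow> nat) \<Rightarrow> bool" where
  "all_sites_hit K x \<longleftrightarrow> (\<forall>k\<in>{1..K}. \<exists>n\<ge>1. x n = k)"

lemma height_eq_0_iff: "height K x n k = 0 \<longleftrightarrow> (\<forall>m\<in>{1..n}. x m \<noteq> k)"
proof (induction n)
  case (Suc n)
  have "{1..Suc n} = insert (Suc n) {1..n}" by auto
  with Suc show ?case by auto
qed simp

lemma mem_nbrs_self: "k \<in> nbrs K k"
  by (auto simp: nbrs_def)

text \<open>
  This description also covers the null event that some site is never hit. That matters for
  measurability: nothing is assumed about completeness of the probability spaces, so an identity
  that holds only almost everywhere would not suffice there.
\<close>

lemma mem_roots_iff: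
  assumes "k \<in> {1..K}"
  shows "k \<in> roots K x \<longleftrightarrow>
    (\<exists>n. x (Suc n) = k \<and> (\<forall>j\<in>nbrs K k. \<forall>m\<in>{1..n}. x m \<noteq> j))"
proof -
  have fin: "finite (height K x n ` nbrs K k)" "height K x n ` nbrs K k \<noteq> {}" for n
    using mem_nbrs_self by (auto simp: nbrs_def)
  have step: "Max (height K x n ` nbrs K k) + 1 = 1 \<longleftrightarrow>
      (\<forall>j\<in>nbrs K k. \<forall>m\<in>{1..n}. x m \<noteq> j)" for n
    using Max_le_iff[OF fin, of n 0] by (simp add: height_eq_0_iff)
  have "height K x i k = 1 \<Longrightarrow>
      \<exists>n. x (Suc n) = k \<and> (\<forall>j\<in>nbrs K k. \<forall>m\<in>{1..n}. x m \<noteq> j)" for i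
  proof (induction i)
    case (Suc i)
    show ?case
    proof (cases "x (Suc i) = k")
      case True
      with Suc.prems step[of i] show ?thesis by auto
    next
      case False
      with Suc show ?thesis by simp
    qed
  qed simp
  moreover have "\<exists>i\<ge>1. height K x i k = 1"
    if "x (Suc n) = k" "\<forall>j\<in>nbrs K k. \<forall>m\<in>{1..n}. x m \<noteq> j" for n
    using that step[of n] by (intro exI[of _ "Suc n"]) simp
  ultimately show ?thesis
    using assms unfolding roots_def by blast
qed

lemma first_arrival:
  assumes "all_sites_hit K x" "k \<in> {1..K}"
  shows "1 \<le> first_arrival x k" "x (first_arrival x k) = k"
proof -
  have "\<exists>n. 1 \<le> n \<and> x n = k" using assms by (auto simp: all_sites_hit_def)
  from LeastI_ex[OF this] show "1 \<le> first_arrival x k" "x (first_arrival x k) = k"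
    unfolding first_arrival_def by auto
qed

lemma first_arrival_le: "1 \<le> n \<Longrightarrow> x n = k \<Longrightarrow> first_arrival x k \<le> n"
  unfolding first_arrival_def by (rule Least_le) simp

lemma inj_on_first_arrival: "all_sites_hit K x \<Longrightarrow> inj_on (first_arrival x) {1..K}"
  using first_arrival(2) by (intro inj_onI) metis

lemma mem_roots_iff_first_arrival:
  assumes "all_sites_hit K x" "k \<in> {1..K}" "nbrs K k \<subseteq> {1..K}"
  shows "k \<in> roots K x \<longleftrightarrow>
    (\<forall>j\<in>nbrs K k - {k}. first_arrival x k < first_arrival x j)"
proof
  assume "k \<in> roots K x"
  then obtain n where n: "x (Suc n) = k" "\<And>j m. j \<in> nbrs K k \<Longrightarrow> m \<in> {1..n} \<Longrightarrow> x m \<noteq> j"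
    using mem_roots_iff[OF assms(2)] by blast
  show "\<forall>j\<in>nbrs K k - {k}. first_arrival x k < first_arrival x j"
  proof
    fix j assume j: "j \<in> nbrs K k - {k}"
    then have "j \<in> {1..K}" using assms(3) by auto
    note fa = first_arrival[OF assms(1) this]
    have "first_arrival x k \<le> Suc n" using n(1) by (intro first_arrival_le) auto
    moreover have "first_arrival x j \<notin> {1..n}" using n(2)[of j] j fa by auto
    moreover have "first_arrival x j \<noteq> Suc n" using fa(2) n(1) j by auto
    ultimately show "first_arrival x k < first_arrival x j" using fa(1) by auto
  qed
next
  assume less: "\<forall>j\<in>nbrs K k - {k}. first_arrival x k < first_arrival x j"
  note fa = first_arrival[OF assms(1,2)]
  have "x m \<noteq> j" if "j \<in> nbrs K k" "m \<in> {1..first_arrival x k - 1}" for j m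
  proof
    assume "x m = j"
    then have "first_arrival x j \<le> m" using that by (intro first_arrival_le) auto
    also have "m < first_arrival x k" using that fa by auto
    finally have "first_arrival x j < first_arrival x k" .
    with less that(1) show False by (metis DiffI less_asym' singletonD)
  qed
  with fa show "k \<in> roots K x"
    unfolding mem_roots_iff[OF assms(2)]
    by (intro exI[of _ "first_arrival x k - 1"]) auto
qed

section \<open>Blocks of consecutive sites on the cycle\<close>

text \<open>
  The block \<open>site K k 0, site K k 1, \<dots>\<close> starts at the left neighbour of \<open>k\<close>, so that \<open>site K k 1 = k\<close>:
  whether \<open>k\<close> is a root can then be read off inside the block with offsets in \<^typ>\<open>nat\<close>.
\<close>

definition site :: "nat \<Rightarrow> nat \<Rightarrow> nat \<Rightarrow> nat" where
  "site K k t = (k + K - 2 + t) mod K + 1"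

lemma site_in: "0 < K \<Longrightarrow> site K k t \<in> {1..K}"
  unfolding site_def using mod_less_divisor[of K "k + K - 2 + t"] by (auto simp: Suc_le_eq)

lemma site_image_subset: "0 < K \<Longrightarrow> site K k ` T \<subseteq> {1..K}"
  using site_in by blast

lemma site_Suc:
  assumes "k \<in> {1..K}" "t < K"
  shows "site K k (Suc t) = (if k + t \<le> K then k + t else k + t - K)"
proof -
  have "(k + K - 2 + Suc t) mod K = (k + t - 1 + K) mod K"
    using assms by (intro arg_cong[of _ _ "\<lambda>n. n mod K"]) auto
  also have "\<dots> = (k + t - 1) mod K" by simp
  also have "\<dots> = (if k + t \<le> K then k + t - 1 else k + t - 1 - K)"
    using assms by (auto simp: mod_if)
  finally show ?thesis using assms unfolding site_def by auto
qed

lemma nbrs_site: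
  assumes "3 \<le> K" "0 < k"
  shows "nbrs K (site K k (Suc t)) = {site K k t, site K k (Suc t), site K k (Suc (Suc t))}"
proof -
  define a where "a = (k + K - 2 + t) mod K"
  have a: "a < K" using assms by (simp add: a_def)
  have "site K k t = a + 1" by (simp add: site_def a_def)
  moreover have "site K k (Suc t) = Suc a mod K + 1"
    by (simp add: site_def a_def mod_Suc_eq)
  moreover have "site K k (Suc (Suc t)) = Suc (Suc a) mod K + 1"
    by (simp add: site_def a_def mod_Suc_Suc_eq)
  moreover have "Suc (Suc a) mod K = 1" if "Suc a = K"
    using that assms mod_add_self1[of K 1] by auto
  ultimately show ?thesis
    using a assms by (cases "Suc a = K"; cases "Suc (Suc a) = K") (auto simp: nbrs_def)
qed

lemma mod_add_left_cancel:
  fixes c s t K :: nat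
  assumes "(c + s) mod K = (c + t) mod K" "s < K" "t < K"
  shows "s = t"
proof -
  have "s = t" if "s \<le> t" "(c + s) mod K = (c + t) mod K" "t < K" for s t :: nat
  proof -
    have "K dvd (c + t) - (c + s)" using that by (subst mod_eq_dvd_iff_nat[symmetric]) auto
    with that show "s = t" by (auto dest: dvd_imp_le)
  qed
  from this[of s t] this[of t s] assms show ?thesis by (cases s t rule: linorder_cases) auto
qed

lemma inj_on_site_offset: "m \<le> K \<Longrightarrow> inj_on (site K k) {..<m}"
  by (rule inj_onI) (auto simp: site_def intro: mod_add_left_cancel[of "k + K - 2" _ K])

lemma inj_on_site_base: "inj_on (\<lambda>k. site K k t) {1..K}"
proof (rule inj_onI)
  fix k l assume *: "k \<in> {1..K}" "l \<in> {1..K}" "site K k t = site K l t"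
  show "k = l"
  proof (cases "K = 1")
    case False
    have "k + K - 2 + t = (K - 1 + t) + (k - 1)" "l + K - 2 + t = (K - 1 + t) + (l - 1)"
      using * False by auto
    with * have "((K - 1 + t) + (k - 1)) mod K = ((K - 1 + t) + (l - 1)) mod K"
      by (simp add: site_def)
    then have "k - 1 = l - 1" by (rule mod_add_left_cancel) (use * in auto)
    then show ?thesis using * by auto
  qed (use * in auto)
qed

section \<open>The gap count as a sum over blocks\<close>

text \<open>
  A block that does not wrap around the end of the strip is counted by the sum over consecutive
  entries of the sorted list of roots. A block that wraps around can only start at the largest root
  and end at the smallest, and it is counted by the final summand of \<^const>\<open>root_gaps\<close>.
\<close>

lemma root_gaps_eq_sum:
  assumes "i + 1 < K"
  shows "root_gaps i K x = (\<Sum>k\<in>{1..K}. of_bool (site K k 1 \<in> roots K x \<and>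
    (\<forall>t\<in>{2..i+1}. site K k t \<notin> roots K x) \<and> site K k (i + 2) \<in> roots K x))"
    (is "_ = (\<Sum>k\<in>{1..K}. of_bool (?P k))")
proof -
  define R where "R = roots K x"
  define xs where "xs = sorted_list_of_set R"
  define n where "n = card R"
  have RK: "R \<subseteq> {1..K}" and finR: "finite R"
    using finite_subset[of R "{1..K}"] by (auto simp: R_def roots_def)
  have len: "length xs = n" and set: "set xs = R" and srt: "sorted_wrt (<) xs"
    and distinct: "distinct xs"
    using finR by (simp_all add: xs_def n_def)
  have mono: "xs ! a < xs ! b" if "a < b" "b < n" for a b
    using sorted_wrt_nth_less[OF srt] that len by auto
  have mono_iff: "xs ! a < xs ! b \<longleftrightarrow> a < b" if "a < n" "b < n" for a b
    using mono[of a b] mono[of b a] that by (cases a b rule: linorder_cases) auto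
  \<comment> \<open>Blocks that stay inside the strip: no reduction modulo \<open>K\<close> takes place.\<close>
  have inner: "?P k \<longleftrightarrow> k \<in> R \<and> (\<forall>l. k < l \<and> l < k + i + 1 \<longrightarrow> l \<notin> R) \<and> k + i + 1 \<in> R"
    if "k \<in> {1..K - i - 1}" for k
  proof -
    have s: "site K k (Suc t) = k + t" if "t \<le> i + 1" for t
      using site_Suc[of k K t] that \<open>k \<in> _\<close> assms by auto
    have "(\<forall>t\<in>{2..i+1}. site K k t \<notin> R) \<longleftrightarrow> (\<forall>l. k < l \<and> l < k + i + 1 \<longrightarrow> l \<notin> R)"
    proof safe
      fix l assume *: "\<forall>t\<in>{2..i+1}. site K k t \<notin> R" "k < l" "l < k + i + 1" "l \<in> R"
      then have "site K k (Suc (l - k)) \<notin> R" by (intro *(1)[rule_format]) auto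
      with * s[of "l - k"] show False by simp
    next
      fix t assume *: "\<forall>l. k < l \<and> l < k + i + 1 \<longrightarrow> l \<notin> R" "t \<in> {2..i+1}" "site K k t \<in> R"
      then have "k < k + (t - 1)" "k + (t - 1) < k + i + 1" by auto
      then have "k + (t - 1) \<notin> R" using *(1) by blast
      moreover have "site K k t = k + (t - 1)" using *(2) s[of "t - 1"] by (cases t) auto
      ultimately show False using *(3) by simp
    qed
    then show ?thesis using s[of 0] s[of "i + 1"] by (simp add: R_def)
  qed
  \<comment> \<open>Blocks that wrap around: no root can lie above \<open>k\<close> or below the second end of the gap.\<close>
  have outer: "?P k \<longleftrightarrow> R \<noteq> {} \<and> k = Max R \<and> Min R + K = k + i + 1"
    if "k \<in> {K - i..K}" for k
  proof -
    have k: "k \<in> {1..K}" using that assms by auto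
    have s: "site K k (Suc t) = (if k + t \<le> K then k + t else k + t - K)" if "t \<le> i + 1" for t
      using site_Suc[OF k, of t] that assms by auto
    have s1: "site K k 1 = k" using s[of 0] k by simp
    have s2: "site K k (i + 2) = k + i + 1 - K"
      using s[of "i + 1"] that by auto
    show ?thesis
    proof
      assume P: "?P k"
      have none: "site K k (Suc t) \<notin> R" if "t \<in> {1..i}" for t
        using P that by (auto simp: R_def)
      have kR: "k \<in> R" and lR: "k + i + 1 - K \<in> R" using P s1 s2 by (auto simp: R_def)
      have "l \<le> k" if "l \<in> R" for l
      proof (rule ccontr)
        assume "\<not> l \<le> k"
        moreover have "l \<le> K" using that RK by auto
        ultimately have "l - k \<in> {1..i}" "k + (l - k) = l" "l \<le> K"
          using \<open>k \<in> {K - i..K}\<close> by auto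
        with none[of "l - k"] s[of "l - k"] that show False by simp
      qed
      moreover have "k + i + 1 - K \<le> l" if "l \<in> R" for l
      proof (rule ccontr)
        assume "\<not> k + i + 1 - K \<le> l"
        moreover have "1 \<le> l" using that RK by auto
        ultimately have "l + K - k \<in> {1..i}" "k + (l + K - k) = l + K" "1 \<le> l"
          using k by auto
        with none[of "l + K - k"] s[of "l + K - k"] that show False by simp
      qed
      ultimately show "R \<noteq> {} \<and> k = Max R \<and> Min R + K = k + i + 1"
        using kR lR finR Max_eqI[of R k] Min_eqI[of R "k + i + 1 - K"] that by auto
    next
      assume *: "R \<noteq> {} \<and> k = Max R \<and> Min R + K = k + i + 1"
      have "Max R \<in> R" "Min R \<in> R" using * finR by auto
      moreover have "Max R = k" "Min R = k + i + 1 - K" using * by linarith+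
      ultimately have "k \<in> R" "k + i + 1 - K \<in> R" by simp_all
      moreover have "site K k t \<notin> R" if "t \<in> {2..i+1}" for t
      proof
        assume "site K k t \<in> R"
        from Max_ge[OF finR this] Min_le[OF finR this] *
        have "site K k t \<le> k" "k + i + 1 \<le> site K k t + K" by linarith+
        moreover obtain u where "t = Suc u" "1 \<le> u" "u \<le> i" using \<open>t \<in> _\<close> by (cases t) auto
        ultimately show False using s[of u] k by (simp split: if_splits)
      qed
      ultimately show "?P k" using s1 s2 unfolding R_def by auto
    qed
  qed
  \<comment> \<open>The gap starting at \<open>k\<close> corresponds to the index \<open>j\<close> of the entry that follows \<open>k\<close>.\<close>
  define A where "A = {k\<in>{1..K - i - 1}. ?P k}"
  define J where "J = {j\<in>{1..n - 1}. xs ! j = xs ! (j - 1) + i + 1}"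
  have "bij_betw (\<lambda>j. xs ! (j - 1)) J A"
  proof (rule bij_betwI')
    show "xs ! (j - 1) = xs ! (j' - 1) \<longleftrightarrow> j = j'" if "j \<in> J" "j' \<in> J" for j j'
    proof
      assume eq: "xs ! (j - 1) = xs ! (j' - 1)"
      have "1 \<le> j" "1 \<le> j'" "j - 1 < n" "j' - 1 < n" using that by (auto simp: J_def)
      with eq len distinct have "j - 1 = j' - 1" by (simp add: nth_eq_iff_index_eq)
      with \<open>1 \<le> j\<close> \<open>1 \<le> j'\<close> show "j = j'" by linarith
    qed simp
  next
    fix j assume j: "j \<in> J"
    define k where "k = xs ! (j - 1)"
    have jn: "j - 1 < n" "j < n" "1 \<le> j" and k': "xs ! j = k + i + 1"
      using j by (auto simp: J_def k_def)
    have kR: "k \<in> R" "k + i + 1 \<in> R"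
      using jn nth_mem[of "j - 1" xs] nth_mem[of j xs] len set k' by (auto simp: k_def)
    moreover have "l \<notin> R" if l: "k < l" "l < k + i + 1" for l
    proof
      assume "l \<in> R"
      then obtain a where a: "a < n" "l = xs ! a" using set len by (metis in_set_conv_nth)
      have "j - 1 < a" using mono_iff[of "j - 1" a] l(1) a jn by (simp add: k_def)
      moreover have "a < j" using mono_iff[of a j] l(2) a jn k' by simp
      ultimately show False by simp
    qed
    moreover have "k \<in> {1..K - i - 1}" using RK kR by auto
    ultimately show "xs ! (j - 1) \<in> A" using inner[of k] by (auto simp: A_def k_def)
  next
    fix k assume "k \<in> A"
    then have k: "k \<in> R" "k + i + 1 \<in> R" "\<And>l. k < l \<Longrightarrow> l < k + i + 1 \<Longrightarrow> l \<notin> R"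
      using inner[of k] by (auto simp: A_def)
    obtain a where a: "a < n" "xs ! a = k" using k set len by (metis in_set_conv_nth)
    obtain b where b: "b < n" "xs ! b = k + i + 1" using k set len by (metis in_set_conv_nth)
    have "a < b" using mono_iff[of a b] a b by simp
    moreover have "\<not> a + 1 < b"
    proof
      assume *: "a + 1 < b"
      have "xs ! (a + 1) \<in> R" using * b set len by (metis less_trans nth_mem)
      with k(3)[of "xs ! (a + 1)"] mono[of a "a + 1"] mono[of "a + 1" b] a b * show False
        by auto
    qed
    ultimately have "b = a + 1" by simp
    with a b show "\<exists>j\<in>J. k = xs ! (j - 1)"
      by (intro bexI[of _ b]) (auto simp: J_def)
  qed
  then have card: "card J = card A" by (rule bij_betw_same_card)
  have first: "(\<Sum>j = 1..n - 1. of_bool (root_at K x (j + 1) - root_at K x j = int i + 1))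
      = real (card J)"
    unfolding J_def root_at_def R_def[symmetric] xs_def[symmetric]
    by (subst sum_of_bool_eq) (auto intro!: arg_cong[where f = card])
  have last: "(\<Sum>k\<in>{K - i..K}. of_bool (?P k)) =
      (of_bool (root_at K x n - root_at K x 1 = int K - int i - 1) :: real)"
  proof (cases "R = {}")
    case True
    \<comment> \<open>Without roots both lookups in the empty list give the same default value, and \<open>K - i - 1 > 0\<close>.\<close>
    then have "root_at K x n = root_at K x 1" by (simp add: root_at_def n_def)
    moreover have "(\<Sum>k\<in>{K - i..K}. of_bool (?P k)) = (0::real)"
      using outer True by (intro sum.neutral) auto
    ultimately show ?thesis using assms by simp
  next
    case False
    have n0: "0 < n" using False finR by (simp add: n_def card_gt_0_iff)
    have hd: "xs ! 0 = Min R"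
    proof (rule Min_eqI[symmetric, OF finR])
      show "xs ! 0 \<in> R" using n0 len set by auto
      fix l assume "l \<in> R"
      then obtain a where "a < n" "l = xs ! a" using set len by (metis in_set_conv_nth)
      then show "xs ! 0 \<le> l" using mono[of 0 a] by (cases "a = 0") auto
    qed
    have lst: "xs ! (n - 1) = Max R"
    proof (rule Max_eqI[symmetric, OF finR])
      show "xs ! (n - 1) \<in> R" using n0 len set by auto
      fix l assume "l \<in> R"
      then obtain a where "a < n" "l = xs ! a" using set len by (metis in_set_conv_nth)
      moreover from this have "a = n - 1 \<or> a < n - 1" by linarith
      ultimately show "l \<le> xs ! (n - 1)" using mono[of a "n - 1"] by fastforce
    qed
    have MinMax: "1 \<le> Min R" "Max R \<le> K"
      using subsetD[OF RK Min_in[OF finR False]] subsetD[OF RK Max_in[OF finR False]] by auto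
    have "(\<Sum>k\<in>{K - i..K}. of_bool (?P k)) =
        (\<Sum>k\<in>{K - i..K}. if k = Max R then of_bool (Min R + K = Max R + i + 1) else (0::real))"
    proof (intro sum.cong refl)
      fix k assume k: "k \<in> {K - i..K}"
      show "of_bool (?P k) = (if k = Max R then of_bool (Min R + K = Max R + i + 1) else (0::real))"
        unfolding outer[OF k] using False by simp
    qed
    also have "\<dots> = of_bool (Min R + K = Max R + i + 1)"
      using MinMax by (subst sum.delta) auto
    also have "Min R + K = Max R + i + 1 \<longleftrightarrow> root_at K x n - root_at K x 1 = int K - int i - 1"
      unfolding root_at_def R_def[symmetric] xs_def[symmetric] using hd lst by auto
    finally show ?thesis .
  qed
  have "{1..K} = {1..K - i - 1} \<union> {K - i..K}" using assms by auto
  then have "(\<Sum>k\<in>{1..K}. of_bool (?P k)) =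
      (\<Sum>k\<in>{1..K - i - 1}. of_bool (?P k)) + ((\<Sum>k\<in>{K - i..K}. of_bool (?P k)) :: real)"
    using assms by (simp only:) (rule sum.union_disjoint; auto)
  also have "(\<Sum>k\<in>{1..K - i - 1}. of_bool (?P k)) = real (card A)"
    unfolding A_def by (subst sum_of_bool_eq) (auto intro!: arg_cong[where f = card])
  finally have total: "(\<Sum>k\<in>{1..K}. of_bool (?P k)) =
      real (card A) + (\<Sum>k\<in>{K - i..K}. of_bool (?P k))" .
  have "num_roots K x = n" by (simp add: num_roots_def n_def R_def)
  then show ?thesis by (simp only: root_gaps_def first card total last)
qed

section \<open>Order patterns\<close>

definition order_pattern :: "nat \<Rightarrow> ((nat \<Rightarrow> nat) \<Rightarrow> bool) \<Rightarrow> bool" where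
  "order_pattern m Q \<longleftrightarrow>
     (\<forall>f g. (\<forall>s<m. \<forall>t<m. f s < f t \<longleftrightarrow> g s < g t) \<longrightarrow> Q f = Q g)"

definition pattern_prob :: "nat \<Rightarrow> ((nat \<Rightarrow> nat) \<Rightarrow> bool) \<Rightarrow> real" where
  "pattern_prob m Q = real (card {\<sigma>. \<sigma> permutes {..<m} \<and> Q \<sigma>}) / fact m"

lemma order_patternD:
  assumes "order_pattern m Q" "\<And>s t. s < m \<Longrightarrow> t < m \<Longrightarrow> f s < f t \<longleftrightarrow> g s < g t"
  shows "Q f \<longleftrightarrow> Q g"
  using assms unfolding order_pattern_def by blast

lemma order_isomorphic_permutation:
  fixes f :: "nat \<Rightarrow> nat"
  assumes inj: "inj_on f {..<m}"
  obtains \<rho> where "\<rho> permutes {..<m}" "\<And>s t. s < m \<Longrightarrow> t < m \<Longrightarrow> \<rho> s < \<rho> t \<longleftrightarrow> f s < f t"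
proof
  \<comment> \<open>The permutation sends each point to the rank of its value.\<close>
  define \<rho> where "\<rho> t = (if t < m then card {s\<in>{..<m}. f s < f t} else t)" for t
  have less: "\<rho> s < \<rho> t" if "s < m" "t < m" "f s < f t" for s t
  proof -
    have "{r\<in>{..<m}. f r < f s} \<subset> {r\<in>{..<m}. f r < f t}" using that by auto
    from psubset_card_mono[OF _ this] show ?thesis using that by (simp add: \<rho>_def)
  qed
  show iff: "\<rho> s < \<rho> t \<longleftrightarrow> f s < f t" if "s < m" "t < m" for s t
  proof (cases "s = t")
    case False
    then have "f s \<noteq> f t" using inj that by (auto dest: inj_onD)
    then show ?thesis using less[of s t] less[of t s] that by (metis linorder_neqE_nat less_asym)
  qed simp
  have "\<rho> t < m" if "t < m" for t
  proof -
    have "{s\<in>{..<m}. f s < f t} \<subset> {..<m}" using that by auto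
    from psubset_card_mono[OF _ this] show ?thesis using that by (simp add: \<rho>_def)
  qed
  moreover have "inj_on \<rho> {..<m}"
    using iff inj by (intro inj_onI) (metis inj_onD lessThan_iff less_irrefl linorder_neqE_nat)
  ultimately have "bij_betw \<rho> {..<m} {..<m}"
    by (intro bij_betw_imageI endo_inj_surj) auto
  then show "\<rho> permutes {..<m}"
    by (rule bij_imp_permutes) (simp add: \<rho>_def)
qed

text \<open>
  Reordering the arguments of \<open>f\<close> in all ways produces every relative order exactly once: composing
  with the rank permutation of \<open>f\<close> is a bijection of the permutations. The count is therefore the
  same for all injective \<open>f\<close>, which is what makes the averaged event below deterministic.
\<close>

lemma card_pattern_permutations:
  assumes Q: "order_pattern m Q" and inj: "inj_on f {..<m}"
  shows "card {\<sigma>. \<sigma> permutes {..<m} \<and> Q (f \<circ> \<sigma>)} = card {\<sigma>. \<sigma> permutes {..<m} \<and> Q \<sigma>}"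
proof -
  obtain \<rho> where \<rho>: "\<rho> permutes {..<m}"
      and iff: "\<And>s t. s < m \<Longrightarrow> t < m \<Longrightarrow> \<rho> s < \<rho> t \<longleftrightarrow> f s < f t"
    using order_isomorphic_permutation[OF inj] by blast
  have Q_iff: "Q (\<rho> \<circ> \<sigma>) \<longleftrightarrow> Q (f \<circ> \<sigma>)" if "\<sigma> permutes {..<m}" for \<sigma>
    using permutes_in_image[OF that] iff by (intro order_patternD[OF Q]) auto
  have "bij_betw ((\<circ>) \<rho>) {\<sigma>. \<sigma> permutes {..<m} \<and> Q (f \<circ> \<sigma>)} {\<sigma>. \<sigma> permutes {..<m} \<and> Q \<sigma>}"
  proof (rule bij_betwI[where g = "(\<circ>) (inv \<rho>)"], goal_cases)
    case 1
    then show ?case using \<rho> Q_iff by (auto intro: permutes_compose)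
  next
    case 2
    show ?case
    proof safe
      fix \<sigma> assume \<sigma>: "\<sigma> permutes {..<m}" "Q \<sigma>"
      show inv: "inv \<rho> \<circ> \<sigma> permutes {..<m}"
        using \<sigma>(1) permutes_inv[OF \<rho>] by (rule permutes_compose)
      have "\<rho> \<circ> (inv \<rho> \<circ> \<sigma>) = \<sigma>" using permutes_inv_o(1)[OF \<rho>] by (simp flip: comp_assoc)
      with Q_iff[OF inv] \<sigma>(2) show "Q (f \<circ> (inv \<rho> \<circ> \<sigma>))" by simp
    qed
  qed (use permutes_inv_o[OF \<rho>] in \<open>simp_all flip: comp_assoc\<close>)
  then show ?thesis by (rule bij_betw_same_card)
qed

lemma pattern_prob_pos:
  assumes "order_pattern m Q" "inj_on f {..<m}" "Q f"
  shows "pattern_prob m Q > 0"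
proof -
  have "id \<in> {\<sigma>. \<sigma> permutes {..<m} \<and> Q (f \<circ> \<sigma>)}" using assms(3) permutes_id by simp
  moreover have "finite {\<sigma>. \<sigma> permutes {..<m} \<and> Q (f \<circ> \<sigma>)}"
    by (rule finite_subset[OF _ finite_permutations[of "{..<m}"]]) auto
  ultimately have "card {\<sigma>. \<sigma> permutes {..<m} \<and> Q (f \<circ> \<sigma>)} > 0"
    unfolding card_gt_0_iff by blast
  then show ?thesis
    unfolding pattern_prob_def card_pattern_permutations[OF assms(1,2)] by simp
qed

section \<open>The uniform arrival sequence\<close>

definition arrivals :: "nat \<Rightarrow> (nat \<Rightarrow> nat) measure" where
  "arrivals K = PiM UNIV (\<lambda>_. uniform_count_measure {1..K})"

lemma product_prob_space_uniform:
  "0 < K \<Longrightarrow> product_prob_space (\<lambda>_::nat. uniform_count_measure {1..K::nat})"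
  by (intro product_prob_spaceI prob_space_uniform_count_measure) auto

lemma prob_space_arrivals: "0 < K \<Longrightarrow> prob_space (arrivals K)"
  unfolding arrivals_def by (intro prob_space_PiM prob_space_uniform_count_measure) auto

lemma measurable_arrival [measurable]: "(\<lambda>x. x n) \<in> arrivals K \<rightarrow>\<^sub>M count_space UNIV"
proof -
  have "(\<lambda>x. x n) \<in> arrivals K \<rightarrow>\<^sub>M uniform_count_measure {1..K}"
    unfolding arrivals_def by (rule measurable_component_singleton) simp
  moreover have "(\<lambda>k. k) \<in> uniform_count_measure {1..K} \<rightarrow>\<^sub>M count_space UNIV"
    by (simp add: measurable_cong_sets[OF sets_uniform_count_measure_count_space refl])
  ultimately show ?thesis by (rule measurable_compose)
qed

lemma measurable_first_arrival [measurable]: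
  "(\<lambda>x. first_arrival x k) \<in> arrivals K \<rightarrow>\<^sub>M count_space UNIV"
  unfolding first_arrival_def by measurable

lemma measurable_first_arrival_less [measurable]:
  "Measurable.pred (arrivals K) (\<lambda>x. first_arrival x j < first_arrival x k)"
proof -
  have [measurable]: "(\<lambda>x. first_arrival x k) \<in> borel_measurable (arrivals K)" for k
    by (rule measurable_compose[OF measurable_first_arrival]) simp
  show ?thesis by measurable
qed

lemma measurable_mem_roots [measurable]: "Measurable.pred (arrivals K) (\<lambda>x. k \<in> roots K x)"
proof (cases "k \<in> {1..K}")
  case True
  have [measurable]: "finite (nbrs K k)" by (simp add: nbrs_def)
  show ?thesis unfolding mem_roots_iff[OF True] by measurable
next
  case False
  then have "(\<lambda>x. k \<in> roots K x) = (\<lambda>_. False)" by (auto simp: roots_def)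
  then show ?thesis by simp
qed

lemma measurable_relabel:
  assumes \<pi>: "\<pi> permutes {1..K}"
  shows "(\<lambda>x. \<pi> \<circ> x) \<in> arrivals K \<rightarrow>\<^sub>M arrivals K"
  unfolding arrivals_def comp_def
proof (rule measurable_PiM_single')
  let ?U = "uniform_count_measure {1..K}"
  fix n
  have "\<pi> \<in> ?U \<rightarrow>\<^sub>M ?U"
    using permutes_in_image[OF \<pi>]
    by (simp add: measurable_cong_sets[OF sets_uniform_count_measure_count_space
          sets_uniform_count_measure_count_space])
  with measurable_component_singleton[of n UNIV "\<lambda>_. ?U"]
  show "(\<lambda>x. \<pi> (x n)) \<in> PiM UNIV (\<lambda>_. ?U) \<rightarrow>\<^sub>M ?U"
    by (auto intro: measurable_compose)
qed (use permutes_in_image[OF \<pi>] in \<open>auto simp: space_PiM space_uniform_count_measure PiE_iff Pi_iff\<close>)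

text \<open>
  The symmetry behind all probability computations: the sites are exchangeable.
\<close>

lemma distr_arrivals_relabel:
  assumes "0 < K" and \<pi>: "\<pi> permutes {1..K}"
  shows "distr (arrivals K) (arrivals K) (\<lambda>x. \<pi> \<circ> x) = arrivals K"
proof -
  let ?U = "uniform_count_measure {1..K}"
  interpret product_prob_space "\<lambda>_::nat. ?U" UNIV
    using product_prob_space_uniform[OF assms(1)] .
  note meas = measurable_relabel[OF \<pi>]
  show ?thesis
    unfolding arrivals_def
  proof (rule PiM_eq)
    fix J :: "nat set" and F :: "nat \<Rightarrow> nat set"
    assume J: "finite J" "J \<subseteq> UNIV" and F: "\<And>j. j \<in> J \<Longrightarrow> F j \<in> sets ?U"
    have F': "F j \<subseteq> {1..K}" if "j \<in> J" for j
      using F[OF that] by (simp add: sets_uniform_count_measure)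
    define G where "G j = inv \<pi> ` F j" for j
    have G: "G j \<in> sets ?U" if "j \<in> J" for j
      using F'[OF that] permutes_in_image[OF permutes_inv[OF \<pi>]]
      by (auto simp: G_def sets_uniform_count_measure)
    have G_iff: "y \<in> G j \<longleftrightarrow> \<pi> y \<in> F j" for y j
      unfolding G_def using permutes_inverses[OF \<pi>] by (metis imageE imageI)
    have eq: "emeasure ?U (G j) = emeasure ?U (F j)" if "j \<in> J" for j
      using F'[OF that] G[OF that] permutes_inj_on[OF permutes_inv[OF \<pi>], of "F j"]
      by (simp add: emeasure_uniform_count_measure sets_uniform_count_measure card_image G_def)
    have emb: "prod_emb UNIV (\<lambda>_. ?U) J (PiE J F) = {x \<in> space (PiM UNIV (\<lambda>_. ?U)). \<forall>j\<in>J. x j \<in> F j}"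
      by (auto simp: prod_emb_def space_PiM PiE_iff)
    have "emeasure (distr (PiM UNIV (\<lambda>_. ?U)) (PiM UNIV (\<lambda>_. ?U)) (\<lambda>x. \<pi> \<circ> x))
        (prod_emb UNIV (\<lambda>_. ?U) J (PiE J F)) =
        emeasure (PiM UNIV (\<lambda>_. ?U))
          ((\<lambda>x. \<pi> \<circ> x) -` prod_emb UNIV (\<lambda>_. ?U) J (PiE J F) \<inter> space (PiM UNIV (\<lambda>_. ?U)))"
      using meas F J unfolding arrivals_def by (intro emeasure_distr sets_PiM_I) auto
    also have "(\<lambda>x. \<pi> \<circ> x) -` prod_emb UNIV (\<lambda>_. ?U) J (PiE J F) \<inter> space (PiM UNIV (\<lambda>_. ?U)) =
        {x \<in> space (PiM UNIV (\<lambda>_. ?U)). \<forall>j\<in>J. x j \<in> G j}"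
      using measurable_space[OF meas[unfolded arrivals_def]] unfolding emb by (auto simp: G_iff)
    also have "emeasure (PiM UNIV (\<lambda>_. ?U)) \<dots> = (\<Prod>j\<in>J. emeasure ?U (G j))"
      using J G by (intro emeasure_PiM_Collect) auto
    also have "\<dots> = (\<Prod>j\<in>J. emeasure ?U (F j))"
      using eq by (intro prod.cong) auto
    finally show "emeasure (distr (PiM UNIV (\<lambda>_. ?U)) (PiM UNIV (\<lambda>_. ?U)) (\<lambda>x. \<pi> \<circ> x))
        (prod_emb UNIV (\<lambda>_. ?U) J (PiE J F)) = (\<Prod>j\<in>J. emeasure ?U (F j))" .
  qed simp
qed

text \<open>
  A given site is missed by the first \<open>N\<close> particles with probability \<open>(1 - 1/K)\<^sup>N\<close>.
\<close>

lemma AE_all_sites_hit: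
  assumes "0 < K"
  shows "AE x in arrivals K. all_sites_hit K x"
proof -
  let ?U = "uniform_count_measure {1..K}"
  interpret product_prob_space "\<lambda>_::nat. ?U" UNIV
    using product_prob_space_uniform[OF assms(1)] .
  interpret A: prob_space "arrivals K" using prob_space_arrivals[OF assms] .
  have "AE x in arrivals K. \<exists>n\<ge>1. x n = k" if k: "k \<in> {1..K}" for k
  proof -
    let ?q = "real (K - 1) / real K"
    have bound: "A.prob {x \<in> space (arrivals K). \<forall>n\<ge>1. x n \<noteq> k} \<le> ?q ^ N" for N
    proof -
      have "A.prob {x \<in> space (arrivals K). \<forall>n\<ge>1. x n \<noteq> k} \<le>
          A.prob {x \<in> space (arrivals K). \<forall>n\<in>{1..N}. x n \<noteq> k}"
        by (intro A.finite_measure_mono) auto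
      also have "{x \<in> space (arrivals K). \<forall>n\<in>{1..N}. x n \<noteq> k} =
          {x \<in> space (arrivals K). \<forall>n\<in>{1..N}. x n \<in> {1..K} - {k}}"
        by (auto simp: arrivals_def space_PiM space_uniform_count_measure PiE_iff)
      also have "emeasure (arrivals K) \<dots> = (\<Prod>n\<in>{1..N}. emeasure ?U ({1..K} - {k}))"
        unfolding arrivals_def
        by (intro emeasure_PiM_Collect) (auto simp: sets_uniform_count_measure)
      then have "A.prob {x \<in> space (arrivals K). \<forall>n\<in>{1..N}. x n \<in> {1..K} - {k}} = ?q ^ N"
        using k by (simp add: emeasure_uniform_count_measure A.emeasure_eq_measure ennreal_power)
      finally show ?thesis .
    qed
    have "(\<lambda>N. ?q ^ N) \<longlonglongrightarrow> 0"
      using assms by (intro LIMSEQ_realpow_zero) auto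
    then have "A.prob {x \<in> space (arrivals K). \<forall>n\<ge>1. x n \<noteq> k} \<le> 0"
      using bound by (intro LIMSEQ_le_const) auto
    then have "A.prob {x \<in> space (arrivals K). \<forall>n\<ge>1. x n \<noteq> k} = 0"
      using measure_nonneg by (rule antisym)
    then have "AE x in arrivals K. x \<notin> {x \<in> space (arrivals K). \<forall>n\<ge>1. x n \<noteq> k}"
      by (subst (asm) A.prob_eq_0) auto
    then show ?thesis by (rule AE_mp) (rule AE_I2, auto)
  qed
  then have "AE x in arrivals K. \<forall>k\<in>{1..K}. \<exists>n\<ge>1. x n = k"
    by (subst AE_ball_countable) auto
  then show ?thesis by (simp add: all_sites_hit_def)
qed

section \<open>Counting weakly dependent events\<close>

lemma (in prob_space) prob_eq_expectation_of_bool: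
  assumes [measurable]: "Measurable.pred M P"
  shows "prob {x \<in> space M. P x} = expectation (\<lambda>x. of_bool (P x))"
proof -
  have "expectation (\<lambda>x. of_bool (P x)) = expectation (indicator {x \<in> space M. P x} :: 'a \<Rightarrow> real)"
    by (intro Bochner_Integration.integral_cong) (auto simp: indicator_def)
  then show ?thesis by (simp add: Int_absorb1 subset_iff)
qed

lemma (in prob_space) integrable_of_bool:
  assumes [measurable]: "Measurable.pred M P"
  shows "integrable M (\<lambda>x. of_bool (P x) :: real)"
  by (rule integrable_const_bound[of _ 1]) auto

text \<open>
  Expanding the square leaves one covariance for each pair of events. It vanishes for pairs outside
  the dependency neighbourhoods \<open>N\<close> and is at most \<open>1\<close> for all others.
\<close>

lemma (in prob_space) variance_count_le:
  fixes A :: "'b \<Rightarrow> 'a \<Rightarrow> bool" and N :: "'b \<Rightarrow> 'b set"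
  assumes S: "finite S"
    and meas [measurable]: "\<And>k. k \<in> S \<Longrightarrow> Measurable.pred M (A k)"
    and p: "\<And>k. k \<in> S \<Longrightarrow> prob {x \<in> space M. A k x} = p"
    and indep: "\<And>k l. k \<in> S \<Longrightarrow> l \<in> S - N k \<Longrightarrow> prob {x \<in> space M. A k x \<and> A l x} = p * p"
    and N: "\<And>k. k \<in> S \<Longrightarrow> card (S \<inter> N k) \<le> c"
  shows "expectation (\<lambda>x. (\<Sum>k\<in>S. of_bool (A k x))) = real (card S) * p"
    and "variance (\<lambda>x. (\<Sum>k\<in>S. of_bool (A k x))) \<le> real (card S) * real c"
proof -
  let ?I = "\<lambda>k x. of_bool (A k x) :: real"
  note int [simp] = integrable_of_bool
  have E: "expectation (?I k) = p" if "k \<in> S" for k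
    using p[OF that] prob_eq_expectation_of_bool[OF meas[OF that]] by simp
  show mean: "expectation (\<lambda>x. (\<Sum>k\<in>S. ?I k x)) = real (card S) * p"
    using E by (subst Bochner_Integration.integral_sum) (auto intro!: int meas)
  have p01: "0 \<le> p" "p \<le> 1" if "k \<in> S" for k
    using p[OF that] by (metis measure_nonneg, metis prob_le_1)
  have prod: "(?I k x - p) * (?I l x - p) =
      of_bool (A k x \<and> A l x) - p * ?I k x - p * ?I l x + p * p" for k l x
    by (simp add: algebra_simps)
  have intk: "integrable M (\<lambda>x. (?I k x - p) * (?I l x - p))" if "k \<in> S" "l \<in> S" for k l
    unfolding prod using that
    by (intro Bochner_Integration.integrable_add Bochner_Integration.integrable_diff
        integrable_mult_right int integrable_const pred_intros_logic meas)
  have cov: "expectation (\<lambda>x. (?I k x - p) * (?I l x - p)) =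
      prob {x \<in> space M. A k x \<and> A l x} - p * p" if "k \<in> S" "l \<in> S" for k l
  proof -
    have [measurable]: "Measurable.pred M (A k)" "Measurable.pred M (A l)"
      using that meas by auto
    show ?thesis
      unfolding prod using that E by (simp add: prob_eq_expectation_of_bool prob_space)
  qed
  have "variance (\<lambda>x. (\<Sum>k\<in>S. ?I k x)) = expectation (\<lambda>x. (\<Sum>k\<in>S. \<Sum>l\<in>S. (?I k x - p) * (?I l x - p)))"
    unfolding mean by (simp add: power2_eq_square sum_product sum_subtractf flip: sum_product)
  also have "\<dots> = (\<Sum>k\<in>S. \<Sum>l\<in>S. prob {x \<in> space M. A k x \<and> A l x} - p * p)"
    using intk cov by (simp add: Bochner_Integration.integral_sum)
  also have "\<dots> \<le> (\<Sum>k\<in>S. real c)"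
  proof (rule sum_mono)
    fix k assume k: "k \<in> S"
    have "(\<Sum>l\<in>S. prob {x \<in> space M. A k x \<and> A l x} - p * p) \<le> (\<Sum>l\<in>S. of_bool (l \<in> N k))"
    proof (rule sum_mono)
      fix l assume l: "l \<in> S"
      show "prob {x \<in> space M. A k x \<and> A l x} - p * p \<le> of_bool (l \<in> N k)"
      proof (cases "l \<in> N k")
        case True
        have "prob {x \<in> space M. A k x \<and> A l x} - p * p \<le> 1"
          using prob_le_1[of "{x \<in> space M. A k x \<and> A l x}"] zero_le_square[of p] by linarith
        with True show ?thesis by simp
      qed (use indep[OF k] l in simp)
    qed
    also have "\<dots> = real (card (S \<inter> N k))" using S by (simp add: Int_def)
    finally show "(\<Sum>l\<in>S. prob {x \<in> space M. A k x \<and> A l x} - p * p) \<le> real c"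
      using N[OF k] by linarith
  qed
  finally show "variance (\<lambda>x. (\<Sum>k\<in>S. ?I k x)) \<le> real (card S) * real c" by simp
qed

section \<open>Independence of the order on a block\<close>

lemma first_arrival_relabel:
  assumes "\<pi> permutes S"
  shows "first_arrival (inv \<pi> \<circ> x) k = first_arrival x (\<pi> k)"
  unfolding first_arrival_def comp_def using permutes_inverses[OF assms] by metis

text \<open>
  A permutation \<open>\<sigma>\<close> of the block can be applied to the labels of the arriving particles without
  changing the law or the event \<open>B\<close>. All the events with \<open>g\<close> replaced by \<open>g \<circ> \<sigma>\<close> thus have the same
  probability, and almost surely the number of \<open>\<sigma>\<close> for which the pattern appears is the same
  constant. Summing over \<open>\<sigma>\<close> gives the product formula. The event \<open>B\<close> will be a pattern on a
  disjoint block.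
\<close>

lemma prob_pattern_and_invariant:
  fixes g :: "nat \<Rightarrow> nat"
  assumes K: "0 < K" and Q: "order_pattern m Q"
    and g: "inj_on g {..<m}" "g ` {..<m} \<subseteq> {1..K}"
    and Qmeas [measurable]: "\<And>h. Measurable.pred (arrivals K) (\<lambda>x. Q (\<lambda>t. first_arrival x (h t)))"
    and Bmeas [measurable]: "Measurable.pred (arrivals K) B"
    and B: "\<And>\<pi> x. \<pi> permutes g ` {..<m} \<Longrightarrow> B (inv \<pi> \<circ> x) \<longleftrightarrow> B x"
  shows "measure (arrivals K) {x \<in> space (arrivals K). Q (\<lambda>t. first_arrival x (g t)) \<and> B x} =
    pattern_prob m Q * measure (arrivals K) {x \<in> space (arrivals K). B x}"
proof -
  interpret A: prob_space "arrivals K" using prob_space_arrivals[OF K] .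
  let ?S = "{\<sigma>. \<sigma> permutes {..<m}}"
  let ?E = "\<lambda>\<sigma>. {x \<in> space (arrivals K). Q (\<lambda>t. first_arrival x (g (\<sigma> t))) \<and> B x}"
  define N where "N = card {\<sigma>. \<sigma> permutes {..<m} \<and> Q \<sigma>}"
  have relabel: "A.prob (?E \<sigma>) = A.prob (?E id)" if \<sigma>: "\<sigma> permutes {..<m}" for \<sigma>
  proof -
    define \<pi> where "\<pi> y = (if y \<in> g ` {..<m} then g (\<sigma> (inv_into {..<m} g y)) else y)" for y
    have "bij_betw g {..<m} (g ` {..<m})" using g(1) by (simp add: bij_betw_def)
    from permutes_bij_inv_into[OF \<sigma> this] have \<pi>: "\<pi> permutes g ` {..<m}"
      unfolding \<pi>_def .
    then have \<pi>K: "\<pi> permutes {1..K}" using g(2) by (rule permutes_subset)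
    have \<pi>g: "\<pi> (g t) = g (\<sigma> t)" if "t < m" for t
      using that g(1) by (simp add: \<pi>_def inv_into_f_f)
    have Q_iff: "Q (\<lambda>t. first_arrival x (\<pi> (g t))) \<longleftrightarrow> Q (\<lambda>t. first_arrival x (g (\<sigma> t)))" for x
      by (rule order_patternD[OF Q]) (simp add: \<pi>g)
    have "A.prob (?E id) = measure (distr (arrivals K) (arrivals K) (\<lambda>x. inv \<pi> \<circ> x)) (?E id)"
      by (simp only: distr_arrivals_relabel[OF K permutes_inv[OF \<pi>K]])
    also have "\<dots> = A.prob ((\<lambda>x. inv \<pi> \<circ> x) -` ?E id \<inter> space (arrivals K))"
      by (rule measure_distr[OF measurable_relabel[OF permutes_inv[OF \<pi>K]]]) simp
    also have "(\<lambda>x. inv \<pi> \<circ> x) -` ?E id \<inter> space (arrivals K) = ?E \<sigma>"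
      using measurable_space[OF measurable_relabel[OF permutes_inv[OF \<pi>K]]]
      by (auto simp: first_arrival_relabel[OF \<pi>] B[OF \<pi>] Q_iff)
    finally show ?thesis by simp
  qed
  have finS: "finite ?S" by (simp add: finite_permutations)
  have "(\<Sum>\<sigma>\<in>?S. A.prob (?E \<sigma>)) =
      A.expectation (\<lambda>x. \<Sum>\<sigma>\<in>?S. of_bool (Q (\<lambda>t. first_arrival x (g (\<sigma> t))) \<and> B x))"
    by (subst Bochner_Integration.integral_sum)
      (auto simp: A.prob_eq_expectation_of_bool intro!: A.integrable_of_bool)
  also have "\<dots> = A.expectation (\<lambda>x. real N * of_bool (B x))"
  proof (rule integral_cong_AE)
    show "AE x in arrivals K. (\<Sum>\<sigma>\<in>?S. of_bool (Q (\<lambda>t. first_arrival x (g (\<sigma> t))) \<and> B x)) =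
        real N * of_bool (B x)"
      using AE_all_sites_hit[OF K]
    proof eventually_elim
      fix x assume "all_sites_hit K x"
      then have "inj_on (\<lambda>t. first_arrival x (g t)) {..<m}"
        using comp_inj_on[OF g(1) inj_on_subset[OF inj_on_first_arrival g(2)]] by (simp add: comp_def)
      from card_pattern_permutations[OF Q this]
      have "card (?S \<inter> {\<sigma>. Q (\<lambda>t. first_arrival x (g (\<sigma> t)))}) = N"
        by (simp add: N_def comp_def Int_def)
      with finS show "(\<Sum>\<sigma>\<in>?S. of_bool (Q (\<lambda>t. first_arrival x (g (\<sigma> t))) \<and> B x)) =
          real N * of_bool (B x)"
        by (cases "B x") (simp_all del: mem_Collect_eq)
    qed
  qed measurable
  also have "\<dots> = real N * A.prob {x \<in> space (arrivals K). B x}"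
    by (simp add: A.prob_eq_expectation_of_bool)
  finally have "fact m * A.prob (?E id) = real N * A.prob {x \<in> space (arrivals K). B x}"
    using relabel card_permutations[of "{..<m}" m] by simp
  then show ?thesis by (simp add: pattern_prob_def N_def field_simps)
qed

section \<open>The pattern of a gap between consecutive roots\<close>

text \<open>
  Used only for \<open>t \<ge> 1\<close>, so that the predecessor is not truncated.
\<close>

definition local_min :: "(nat \<Rightarrow> nat) \<Rightarrow> nat \<Rightarrow> bool" where
  "local_min f t \<longleftrightarrow> f t < f (t - 1) \<and> f t < f (t + 1)"

definition gap_pattern :: "nat \<Rightarrow> (nat \<Rightarrow> nat) \<Rightarrow> bool" where
  "gap_pattern i f \<longleftrightarrow>
     local_min f 1 \<and> (\<forall>t\<in>{2..i + 1}. \<not> local_min f t) \<and> local_min f (i + 2)"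

lemma order_pattern_gap: "order_pattern (i + 4) (gap_pattern i)"
  unfolding order_pattern_def
proof (intro allI impI)
  fix f g :: "nat \<Rightarrow> nat"
  assume iff: "\<forall>s<i + 4. \<forall>t<i + 4. f s < f t \<longleftrightarrow> g s < g t"
  have "local_min f t \<longleftrightarrow> local_min g t" if "t \<le> i + 2" for t
    using iff that unfolding local_min_def by simp
  then show "gap_pattern i f = gap_pattern i g" by (simp add: gap_pattern_def)
qed

text \<open>
  A witness has its two smallest values at the positions of the two roots and increases strictly
  on the sites in between. Their last site is then higher than both of its neighbours, and each
  earlier one is higher than its left neighbour, so none of them is a local minimum. For \<open>i = 0\<close> two
  adjacent sites would both have to be local minima, which is impossible.
\<close>

lemma gap_pattern_prob_pos:
  assumes "1 \<le> i"
  shows "pattern_prob (i + 4) (gap_pattern i) > 0"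
proof (rule pattern_prob_pos[OF order_pattern_gap])
  define f where "f t = (if t = 0 then i + 4 else if t = 1 then 0 else if t = i + 2 then 1 else t)" for t
  show "inj_on f {..<i + 4}" by (auto simp: inj_on_def f_def split: if_splits)
  show "gap_pattern i f" using assms by (auto simp: gap_pattern_def local_min_def f_def)
qed

lemma measurable_gap_pattern [measurable]:
  "Measurable.pred (arrivals K) (\<lambda>x. gap_pattern i (\<lambda>t. first_arrival x (h t)))"
  unfolding gap_pattern_def local_min_def by measurable

definition gap_at :: "nat \<Rightarrow> nat \<Rightarrow> (nat \<Rightarrow> nat) \<Rightarrow> nat \<Rightarrow> bool" where
  "gap_at i K x k \<longleftrightarrow> gap_pattern i (\<lambda>t. first_arrival x (site K k t))"

lemma root_gaps_eq_count:
  assumes "all_sites_hit K x" "i + 4 \<le> K"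
  shows "root_gaps i K x = (\<Sum>k\<in>{1..K}. of_bool (gap_at i K x k))"
proof -
  have root: "site K k t \<in> roots K x \<longleftrightarrow> local_min (\<lambda>t. first_arrival x (site K k t)) t"
    if k: "k \<in> {1..K}" and t: "1 \<le> t" "t \<le> i + 2" for k t
  proof -
    obtain u where u: "t = Suc u" using t by (cases t) auto
    have nb: "nbrs K (site K k t) = {site K k u, site K k t, site K k (Suc t)}"
      using nbrs_site[of K k u] assms k u by auto
    have "site K k u \<noteq> site K k t" "site K k (Suc t) \<noteq> site K k t"
      using inj_on_site_offset[of "i + 4" K k] assms t u by (auto dest!: inj_onD)
    then have nb': "nbrs K (site K k t) - {site K k t} = {site K k u, site K k (Suc t)}"
      using nb by auto
    have sites: "site K k s \<in> {1..K}" for s using assms by (intro site_in) auto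
    show ?thesis
      by (subst mem_roots_iff_first_arrival[OF assms(1) sites])
        (use nb nb' sites u in \<open>auto simp: local_min_def\<close>)
  qed
  show ?thesis
    using assms root by (subst root_gaps_eq_sum) (auto simp: gap_at_def gap_pattern_def intro!: sum.cong)
qed

lemma prob_gap_at:
  assumes "i + 4 \<le> K" "k \<in> {1..K}"
  shows "measure (arrivals K) {x \<in> space (arrivals K). gap_at i K x k} =
    pattern_prob (i + 4) (gap_pattern i)"
proof -
  interpret A: prob_space "arrivals K" using assms by (intro prob_space_arrivals) auto
  have "site K k ` {..<i + 4} \<subseteq> {1..K}" using site_image_subset[of K k] assms by simp
  with prob_pattern_and_invariant[of K "i + 4" "gap_pattern i" "site K k" "\<lambda>_. True"]
    inj_on_site_offset[OF assms(1)] order_pattern_gap assms A.prob_space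
  show ?thesis by (simp add: gap_at_def)
qed

lemma prob_gap_at_disjoint:
  assumes K: "i + 4 \<le> K" and k: "k \<in> {1..K}" "l \<in> {1..K}"
    and disj: "site K k ` {..<i + 4} \<inter> site K l ` {..<i + 4} = {}"
  shows "measure (arrivals K) {x \<in> space (arrivals K). gap_at i K x k \<and> gap_at i K x l} =
    pattern_prob (i + 4) (gap_pattern i) * pattern_prob (i + 4) (gap_pattern i)"
proof -
  have inv: "gap_at i K (inv \<pi> \<circ> x) l \<longleftrightarrow> gap_at i K x l"
    if \<pi>: "\<pi> permutes site K k ` {..<i + 4}" for \<pi> x
    unfolding gap_at_def
  proof (rule order_patternD[OF order_pattern_gap])
    have fixed: "\<pi> (site K l t) = site K l t" if "t < i + 4" for t
      using permutes_not_in[OF \<pi>] disj that by blast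
    fix s t assume "s < i + 4" "t < i + 4"
    then show "(first_arrival (inv \<pi> \<circ> x) (site K l s) < first_arrival (inv \<pi> \<circ> x) (site K l t)) =
        (first_arrival x (site K l s) < first_arrival x (site K l t))"
      by (simp add: first_arrival_relabel[OF \<pi>] fixed)
  qed
  have "site K k ` {..<i + 4} \<subseteq> {1..K}" using site_image_subset[of K k] K by simp
  moreover have "Measurable.pred (arrivals K) (\<lambda>x. gap_at i K x l)"
    unfolding gap_at_def by measurable
  ultimately show ?thesis
    using prob_pattern_and_invariant[of K "i + 4" "gap_pattern i" "site K k" "\<lambda>x. gap_at i K x l"]
      inj_on_site_offset[OF K] order_pattern_gap inv K prob_gap_at[OF K k(2)]
    by (simp add: gap_at_def)
qed

text \<open>
  If two blocks share a site, its offsets \<open>s\<close> and \<open>t\<close> in them together with one of the two starting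
  points determine the other starting point.
\<close>

lemma card_meeting_blocks:
  "card ({1..K} \<inter> {l. site K k ` {..<m} \<inter> site K l ` {..<m} \<noteq> {}}) \<le> m * m"
proof -
  define N where "N s t = {l\<in>{1..K}. site K l t = site K k s}" for s t
  have "card (N s t) \<le> 1" for s t
  proof -
    have "l = l'" if "l \<in> N s t" "l' \<in> N s t" for l l'
    proof -
      have "l \<in> {1..K}" "l' \<in> {1..K}" "site K l t = site K l' t"
        using that unfolding N_def mem_Collect_eq by (blast, blast, metis)
      then show ?thesis using inj_on_site_base[of K t] by (metis inj_onD)
    qed
    then show ?thesis by (simp add: card_le_Suc0_iff_eq N_def)
  qed
  moreover have "card (\<Union>(s, t)\<in>{..<m} \<times> {..<m}. N s t) \<le> (\<Sum>(s, t)\<in>{..<m} \<times> {..<m}. card (N s t))"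
    using card_UN_le[of "{..<m} \<times> {..<m}" "\<lambda>(s, t). N s t"] by (simp add: case_prod_beta)
  moreover have "(\<Sum>(s, t)\<in>{..<m} \<times> {..<m}. card (N s t)) \<le> (\<Sum>_\<in>{..<m} \<times> {..<m}. 1)"
    using calculation(1) by (intro sum_mono) (simp add: case_prod_beta)
  moreover have "{1..K} \<inter> {l. site K k ` {..<m} \<inter> site K l ` {..<m} \<noteq> {}} \<subseteq>
      (\<Union>(s, t)\<in>{..<m} \<times> {..<m}. N s t)"
    by (fastforce simp: N_def)
  then have "card ({1..K} \<inter> {l. site K k ` {..<m} \<inter> site K l ` {..<m} \<noteq> {}}) \<le>
      card (\<Union>(s, t)\<in>{..<m} \<times> {..<m}. N s t)"
    by (intro card_mono) (auto simp: N_def)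
  ultimately show ?thesis by simp
qed

lemma measurable_root_gaps:
  assumes "i + 4 \<le> K"
  shows "root_gaps i K \<in> borel_measurable (arrivals K)"
proof -
  have "root_gaps i K = (\<lambda>x. \<Sum>k\<in>{1..K}. of_bool (site K k 1 \<in> roots K x \<and>
      (\<forall>t\<in>{2..i+1}. site K k t \<notin> roots K x) \<and> site K k (i + 2) \<in> roots K x))"
    using assms by (intro ext root_gaps_eq_sum) simp
  then show ?thesis by simp
qed

section \<open>Concentration of the number of gaps\<close>

lemma root_gaps_concentration:
  fixes i K :: nat and p \<epsilon> :: real
  defines "p \<equiv> pattern_prob (i + 4) (gap_pattern i)"
  assumes i: "1 \<le> i" and K: "i + 4 \<le> K" and \<epsilon>: "0 < \<epsilon>"
  shows "(\<integral>x. root_gaps i K x \<partial>arrivals K) = K * p"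
    and "measure (arrivals K) {x \<in> space (arrivals K). \<bar>root_gaps i K x / (K * p) - 1\<bar> > \<epsilon>}
      \<le> (i + 4)\<^sup>2 / (p * \<epsilon>)\<^sup>2 / K"
proof -
  interpret A: prob_space "arrivals K" using K by (intro prob_space_arrivals) auto
  let ?D = "\<lambda>x. \<Sum>k\<in>{1..K}. of_bool (gap_at i K x k) :: real"
  have p: "0 < p" unfolding p_def using i by (rule gap_pattern_prob_pos)
  have meas [measurable]: "Measurable.pred (arrivals K) (\<lambda>x. gap_at i K x k)" for k
    unfolding gap_at_def by measurable
  note [measurable] = measurable_root_gaps[OF K]
  have AE: "AE x in arrivals K. root_gaps i K x = ?D x"
    using AE_all_sites_hit[of K] K by (auto elim!: eventually_mono simp: root_gaps_eq_count)
  have mean: "A.expectation ?D = K * p"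
    and var: "A.variance ?D \<le> K * real ((i + 4) * (i + 4))"
    using A.variance_count_le[of "{1..K}" "\<lambda>k x. gap_at i K x k" p
        "\<lambda>k. {l. site K k ` {..<i + 4} \<inter> site K l ` {..<i + 4} \<noteq> {}}" "(i + 4) * (i + 4)"]
      prob_gap_at[OF K] prob_gap_at_disjoint[OF K] card_meeting_blocks
    by (auto simp: p_def)
  show "A.expectation (root_gaps i K) = K * p"
    using integral_cong_AE[OF _ _ AE] mean by simp
  \<comment> \<open>The count of patterns agrees with the number of gaps almost surely, and the tail bound for it is
    the inequality of Chebyshev.\<close>
  have a: "0 < K * p * \<epsilon>" using p \<epsilon> K by simp
  have "A.prob {x \<in> space (arrivals K). \<bar>root_gaps i K x / (K * p) - 1\<bar> > \<epsilon>} =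
      A.prob {x \<in> space (arrivals K). \<bar>?D x / (K * p) - 1\<bar> > \<epsilon>}"
    using AE by (intro A.finite_measure_eq_AE) (auto elim!: eventually_mono)
  also have "\<dots> \<le> A.prob {x \<in> space (arrivals K). \<bar>?D x - A.expectation ?D\<bar> \<ge> K * p * \<epsilon>}"
  proof (intro A.finite_measure_mono subsetI)
    fix x assume x: "x \<in> {x \<in> space (arrivals K). \<bar>?D x / (K * p) - 1\<bar> > \<epsilon>}"
    have "\<bar>?D x - K * p\<bar> = K * p * \<bar>?D x / (K * p) - 1\<bar>"
    proof -
      have q: "0 < K * p" using p K by simp
      then have "K * p * \<bar>?D x / (K * p) - 1\<bar> = \<bar>K * p * (?D x / (K * p) - 1)\<bar>"
        by (simp only: abs_mult[of "K * p"] abs_of_pos[OF q])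
      also have "K * p * (?D x / (K * p) - 1) = ?D x - K * p"
        using p q by (simp add: right_diff_distrib)
      finally show ?thesis by simp
    qed
    also have "\<dots> \<ge> K * p * \<epsilon>"
      using x p by (intro mult_left_mono) auto
    finally show "x \<in> {x \<in> space (arrivals K). \<bar>?D x - A.expectation ?D\<bar> \<ge> K * p * \<epsilon>}"
      using x mean by simp
  qed measurable
  also have "\<dots> \<le> A.variance ?D / (K * p * \<epsilon>)\<^sup>2"
  proof (rule A.Chebyshev_inequality[OF _ _ a])
    show "integrable (arrivals K) (\<lambda>x. (?D x)\<^sup>2)"
    proof (rule A.integrable_const_bound)
      have "\<bar>?D x\<bar> \<le> K" for x
        using sum_mono[of "{1..K}" "\<lambda>k. of_bool (gap_at i K x k)" "\<lambda>_. 1 :: real"]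
        by (simp add: sum_nonneg)
      then show "AE x in arrivals K. norm ((?D x)\<^sup>2) \<le> (real K)\<^sup>2"
        by (intro AE_I2) (simp add: abs_le_square_iff)
    qed measurable
  qed measurable
  also have "\<dots> \<le> K * real ((i + 4) * (i + 4)) / (K * p * \<epsilon>)\<^sup>2"
    using var by (intro divide_right_mono) auto
  also have "\<dots> = (i + 4)\<^sup>2 / (p * \<epsilon>)\<^sup>2 / K"
  proof -
    have "K * c / (K * q)\<^sup>2 = c / q\<^sup>2 / K" for c q :: real
      by (cases "q = 0") (simp_all add: power2_eq_square)
    from this[of "real ((i + 4) * (i + 4))" "p * \<epsilon>"] show ?thesis
      by (simp add: power2_eq_square mult.assoc)
  qed
  finally show "A.prob {x \<in> space (arrivals K). \<bar>root_gaps i K x / (K * p) - 1\<bar> > \<epsilon>}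
      \<le> (i + 4)\<^sup>2 / (p * \<epsilon>)\<^sup>2 / K" .
qed

text \<open>
  Every probability space carrying the model induces the same law on arrival sequences, so mean and
  tail bound can be computed on \<^const>\<open>arrivals\<close>.
\<close>

lemma distr_eq_arrivals:
  fixes X :: "nat \<Rightarrow> 'a \<Rightarrow> nat"
  assumes "prob_space M"
    and indep: "prob_space.indep_vars M (\<lambda>_. count_space {1..K}) X UNIV"
    and unif: "\<And>n. distr M (count_space {1..K}) (X n) = uniform_count_measure {1..K}"
  shows "(\<lambda>\<omega> n. X n \<omega>) \<in> M \<rightarrow>\<^sub>M arrivals K"
    and "distr M (arrivals K) (\<lambda>\<omega> n. X n \<omega>) = arrivals K"
proof -
  interpret prob_space M by fact
  have X [measurable]: "X n \<in> M \<rightarrow>\<^sub>M count_space {1..K}" for n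
    using indep by (simp add: indep_vars_def)
  have sets: "sets (arrivals K) = sets (PiM UNIV (\<lambda>_::nat. count_space {1..K}))"
    unfolding arrivals_def by (intro sets_PiM_cong refl sets_uniform_count_measure_count_space)
  have "distr M (arrivals K) (\<lambda>\<omega> n. X n \<omega>) =
      distr M (PiM UNIV (\<lambda>_. count_space {1..K})) (\<lambda>\<omega>. \<lambda>n\<in>UNIV. X n \<omega>)"
    using sets by (intro distr_cong) auto
  also have "\<dots> = PiM UNIV (\<lambda>n. distr M (count_space {1..K}) (X n))"
    using indep by (subst (asm) indep_vars_iff_distr_eq_PiM) (auto intro: X[simplified])
  finally show "distr M (arrivals K) (\<lambda>\<omega> n. X n \<omega>) = arrivals K"
    by (simp only: unif arrivals_def)
  have "(\<lambda>\<omega> n. X n \<omega>) \<in> M \<rightarrow>\<^sub>M PiM UNIV (\<lambda>_. count_space {1..K})"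
    using X measurable_space[OF X] by (intro measurable_PiM_single') (auto simp del: One_nat_def)
  then show "(\<lambda>\<omega> n. X n \<omega>) \<in> M \<rightarrow>\<^sub>M arrivals K"
    by (simp add: measurable_cong_sets[OF refl sets])
qed

theorem corollary6:
  fixes M :: "nat \<Rightarrow> 'a measure" and X :: "nat \<Rightarrow> nat \<Rightarrow> 'a \<Rightarrow> nat" and i :: nat
  assumes "\<And>K. 3 \<le> K \<Longrightarrow> prob_space (M K)"
    and "\<And>K. 3 \<le> K \<Longrightarrow>
           prob_space.indep_vars (M K) (\<lambda>_. count_space {1..K}) (X K) UNIV"
    and "\<And>K n. 3 \<le> K \<Longrightarrow>
           distr (M K) (count_space {1..K}) (X K n) = uniform_count_measure {1..K}"
    and "2 \<le> i" and "i \<le> 7"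
  shows "converges_in_probability M
           (\<lambda>K \<omega>. root_gaps i K (\<lambda>n. X K n \<omega>) /
                  prob_space.expectation (M K) (\<lambda>\<omega>'. root_gaps i K (\<lambda>n. X K n \<omega>'))) 1"
proof -
  define p where "p = pattern_prob (i + 4) (gap_pattern i)"
  define Y where "Y K \<omega> = root_gaps i K (\<lambda>n. X K n \<omega>) /
      prob_space.expectation (M K) (\<lambda>\<omega>'. root_gaps i K (\<lambda>n. X K n \<omega>'))" for K \<omega>
  have meas: "(\<lambda>\<omega> n. X K n \<omega>) \<in> M K \<rightarrow>\<^sub>M arrivals K"
    and distr: "distr (M K) (arrivals K) (\<lambda>\<omega> n. X K n \<omega>) = arrivals K" if "i + 4 \<le> K" for K
    using that by (auto intro!: distr_eq_arrivals assms)
  note meas_gaps = measurable_compose[OF meas measurable_root_gaps]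
  have Y: "Y K \<in> borel_measurable (M K)" if "i + 4 \<le> K" for K
    unfolding Y_def using meas_gaps[OF that that] by simp
  have tail: "measure (M K) {\<omega> \<in> space (M K). \<bar>Y K \<omega> - 1\<bar> > \<epsilon>} \<le> (i + 4)\<^sup>2 / (p * \<epsilon>)\<^sup>2 / K"
    if K: "i + 4 \<le> K" and "0 < \<epsilon>" for K \<epsilon>
  proof -
    note [measurable] = meas[OF K] measurable_root_gaps[OF K]
    note conc = root_gaps_concentration[OF _ K \<open>0 < \<epsilon>\<close>, folded p_def]
    have i1: "1 \<le> i" using \<open>2 \<le> i\<close> by simp
    have "prob_space.expectation (M K) (\<lambda>\<omega>. root_gaps i K (\<lambda>n. X K n \<omega>)) =
        (\<integral>x. root_gaps i K x \<partial>distr (M K) (arrivals K) (\<lambda>\<omega> n. X K n \<omega>))"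
      by (rule integral_distr[symmetric]) measurable
    also have "\<dots> = K * p"
      unfolding distr[OF K] by (rule conc(1)[OF i1])
    finally have "measure (M K) {\<omega> \<in> space (M K). \<bar>Y K \<omega> - 1\<bar> > \<epsilon>} =
        measure (M K) ((\<lambda>\<omega> n. X K n \<omega>) -`
          {x \<in> space (arrivals K). \<bar>root_gaps i K x / (K * p) - 1\<bar> > \<epsilon>} \<inter> space (M K))"
      using measurable_space[OF meas[OF K]] unfolding Y_def
      by (intro arg_cong[where f = "measure (M K)"]) auto
    also have "\<dots> = measure (distr (M K) (arrivals K) (\<lambda>\<omega> n. X K n \<omega>))
        {x \<in> space (arrivals K). \<bar>root_gaps i K x / (K * p) - 1\<bar> > \<epsilon>}"
      by (rule measure_distr[symmetric]) measurable
    also have "\<dots> \<le> (i + 4)\<^sup>2 / (p * \<epsilon>)\<^sup>2 / K"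
      unfolding distr[OF K] by (rule conc(2)[OF i1])
    finally show ?thesis .
  qed
  have ev: "\<forall>\<^sub>F K in sequentially. i + 4 \<le> K" by (rule eventually_ge_at_top)
  have "(\<lambda>K. measure (M K) {\<omega> \<in> space (M K). \<bar>Y K \<omega> - 1\<bar> > \<epsilon>}) \<longlonglongrightarrow> 0" if "0 < \<epsilon>" for \<epsilon>
  proof (rule tendsto_sandwich[where f = "\<lambda>_. 0"])
    show "(\<lambda>K. (i + 4)\<^sup>2 / (p * \<epsilon>)\<^sup>2 / real K) \<longlonglongrightarrow> 0" by (rule lim_const_over_n)
    show "\<forall>\<^sub>F K in sequentially.
        measure (M K) {\<omega> \<in> space (M K). \<bar>Y K \<omega> - 1\<bar> > \<epsilon>} \<le> (i + 4)\<^sup>2 / (p * \<epsilon>)\<^sup>2 / real K"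
      using ev by eventually_elim (use tail that in auto)
  qed auto
  moreover have "\<forall>\<^sub>F K in sequentially. prob_space (M K) \<and> Y K \<in> borel_measurable (M K)"
    using ev by eventually_elim (use assms(1) Y in auto)
  ultimately show ?thesis
    unfolding converges_in_probability_def Y_def by auto
qed

end
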